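(* Let $c>0$, let $\mathbb{P}\subset\mathbb{R}^3$ be a plane, let $K\geq 1$ be an integer, let $S'=\{s_j : j=1,2,\ldots,K\}\subset\mathbb{P}$ be a set of mutually distinct source points, and let $\tau_j>0$ ($j=1,\ldots,K$) be the intensities of the point sources. Let $\lambda(t)=\delta(t)$ (the Dirac delta distribution) be the signal function, and let $u(x,t)$ be the (causal) solution to the wave equation $$c^{-2}\partial_{tt}u(x,t)-\triangle u(x,t)=\sum_{j=1}^{K}\lambda(t)\tau_j\delta(x-s_j),\qquad x\in\mathbb{R}^3,\ t\in\mathbb{R}.$$ Assume that $\Omega'\subset\mathbb{P}$ is an open disc of radius $R$ with $S'\subset\Omega'$, with boundary circle $\partial\Omega'$, and that the sampling region $D'\subset\Omega'$ satisfies $S'\subset D'$ and $D'\cap\partial\Omega'=\varnothing$. For $z\in D'$ define the indicator function $$I'(z)=\int_{\mathbb{R}}\int_{\partial\Omega'}u(x,t)\,\big(G(x,t;z)\ast\lambda(t)\big)\,{\rm d}s(x)\,{\rm d}t .$$ Then $$I'(z)=+\infty\ \text{ for } z\in S',\qquad I'(z)<+\infty\ \text{ for } z\in D'\setminus S'.$$ Moreover, $$\lim_{d(z,S')\to 0}I'(z)=+\infty,\qquad\text{where } d(z,S')=\min_{j=1,\ldots,K}|z-s_j|.$$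
   Context: The Green's function of the d'Alembert operator $c^{-2}\partial_{tt}-\triangle$ in $\mathbb{R}^3$ is $G(x,t;s)=\dfrac{\delta(t-c^{-1}|x-s|)}{4\pi|x-s|}$, and $G(x,t;s)\ast\lambda(t)=\dfrac{\lambda(t-c^{-1}|x-s|)}{4\pi|x-s|}$ denotes convolution in time. The signal is causal (the source vanishes for $t<0$), and the solution of the wave equation is $u(x,t)=\sum_{j=1}^{K}\tau_j\,G(x,t;s_j)\ast\lambda(t)$. Here ${\rm d}s(x)$ is arc length on $\partial\Omega'$. Conventions for the delta distributions, since $\lambda=\delta$: the time integral is performed by the rule $\int_{\mathbb{R}}\delta(t-\alpha)\delta(t-\beta)\,{\rm d}t=\delta(\alpha-\beta)$, so that $$I'(z)=\sum_{j=1}^{K}\tau_j\int_{\partial\Omega'}\frac{\delta\left(c^{-1}|x-s_j|-c^{-1}|x-z|\right)}{16\pi^2|x-s_j||x-z|}\,{\rm d}s(x).$$ For a continuous function $f$ and a smooth function $h$ on the circle $\partial\Omega'$ having only finitely many zeros $p_i$, all simple, $\int_{\partial\Omega'}f\,\delta(h)\,{\rm d}s=\sum_i f(p_i)/|h'(p_i)|$, where $h'$ is the derivative with respect to arc length. When $z=s_j$, the $j$-th term involves the square of a delta distribution, $\int_{\mathbb{R}}\int_{\partial\Omega'}\tau_j\frac{\delta^2(t-c^{-1}|x-s_j|)}{16\pi^2|x-s_j|^2}\,{\rm d}s(x)\,{\rm d}t$, and is assigned the value $+\infty$. *)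

theory Defs
  imports "HOL-Analysis.Analysis"
begin

text \<open>
  \<open>Pulse a \<alpha>\<close> stands for the distribution \<open>a(x) \<delta>(t - \<alpha>(x))\<close>: an impulsive wave that passes the
  point \<open>x\<close> at time \<open>\<alpha>(x)\<close> with strength \<open>a(x)\<close>.  A list of pulses stands for their sum.
\<close>

datatype pulse = Pulse (amp: "real^3 \<Rightarrow> real") (delay: "real^3 \<Rightarrow> real")

text \<open>
  The Green's function \<open>G(x,t;s) = \<delta>(t - |x-s|/c) / (4\<pi>|x-s|)\<close> of \<open>c\<^sup>-\<^sup>2 \<partial>\<^sub>t\<^sub>t - \<Delta>\<close>.
  For the signal \<open>\<lambda> = \<delta>\<close> the convolution in time \<open>G(x,t;s) * \<lambda>(t)\<close> is \<open>G(x,t;s)\<close> itself.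
\<close>

definition green :: "real \<Rightarrow> real^3 \<Rightarrow> pulse" where
  "green c s = Pulse (\<lambda>x. 1 / (4 * pi * norm (x - s))) (\<lambda>x. norm (x - s) / c)"

definition scale_pulse :: "real \<Rightarrow> pulse \<Rightarrow> pulse" where
  "scale_pulse r p = Pulse (\<lambda>x. r * amp p x) (delay p)"

text \<open>
  The causal solution of \<open>c\<^sup>-\<^sup>2 \<partial>\<^sub>t\<^sub>t u - \<Delta>u = \<Sum>\<^sub>j \<lambda>(t) \<tau>\<^sub>j \<delta>(x - s\<^sub>j)\<close>, \<open>j = 1, \<dots>, K\<close>, with \<open>\<lambda> = \<delta>\<close>, given by
  its representation \<open>u(x,t) = \<Sum>\<^sub>j \<tau>\<^sub>j G(x,t;s\<^sub>j) * \<lambda>(t)\<close>.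
\<close>

definition wave_solution :: "real \<Rightarrow> nat \<Rightarrow> (nat \<Rightarrow> real^3) \<Rightarrow> (nat \<Rightarrow> real) \<Rightarrow> pulse list" where
  "wave_solution c K s \<tau> = map (\<lambda>j. scale_pulse (\<tau> j) (green c (s j))) [1..<Suc K]"

definition circle_arc :: "real^3 \<Rightarrow> real \<Rightarrow> real^3 \<Rightarrow> real^3 \<Rightarrow> real \<Rightarrow> real^3" where
  "circle_arc a r e1 e2 t = a + (r * cos (t / r)) *\<^sub>R e1 + (r * sin (t / r)) *\<^sub>R e2"

text \<open>\<open>\<gamma>\<close> parametrizes the circle \<open>\<Gamma>\<close> by arc length, running through it once on \<open>[0, L)\<close>.\<close>

definition arclength_circle :: "(real^3) set \<Rightarrow> (real \<Rightarrow> real^3) \<Rightarrow> real \<Rightarrow> bool" where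
  "arclength_circle \<Gamma> \<gamma> L \<longleftrightarrow>
     (\<exists>a r e1 e2. r > 0 \<and> norm e1 = 1 \<and> norm e2 = 1 \<and> e1 \<bullet> e2 = 0 \<and>
        \<gamma> = circle_arc a r e1 e2 \<and> L = 2 * pi * r \<and> \<Gamma> = \<gamma> ` {0..<L})"

definition smooth :: "(real \<Rightarrow> real) \<Rightarrow> bool" where
  "smooth g \<longleftrightarrow> (\<forall>n. (deriv ^^ n) g differentiable_on UNIV)"

text \<open>
  \<open>\<integral>\<^sub>\<Gamma> f \<delta>(h) ds = \<Sum>\<^sub>i f(p\<^sub>i) / |h'(p\<^sub>i)|\<close>, the sum being over the zeros of \<open>h\<close> on the circle \<open>\<Gamma>\<close> and
  \<open>h'\<close> the derivative with respect to arc length; the rule applies to continuous \<open>f\<close> and to smooth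
  \<open>h\<close> with finitely many zeros, all simple.  Two arc-length parametrizations differ by a shift and
  possibly a reversal, so the value does not depend on the one chosen.  Where the rule does not
  apply the value is set to \<open>\<infinity>\<close>, so that finiteness of an integral entails that it is defined.
\<close>

definition delta_integral :: "(real^3) set \<Rightarrow> (real^3 \<Rightarrow> real) \<Rightarrow> (real^3 \<Rightarrow> real) \<Rightarrow> ereal" where
  "delta_integral \<Gamma> f h =
     (let (\<gamma>, L) = (SOME (\<gamma>, L). arclength_circle \<Gamma> \<gamma> L);
          Z = {t \<in> {0..<L}. h (\<gamma> t) = 0}
      in if continuous_on \<Gamma> f \<and> smooth (h \<circ> \<gamma>) \<and> finite Z \<and> (\<forall>t\<in>Z. deriv (h \<circ> \<gamma>) t \<noteq> 0)
         then ereal (\<Sum>t\<in>Z. f (\<gamma> t) / \<bar>deriv (h \<circ> \<gamma>) t\<bar>)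
         else \<infinity>)"

text \<open>
  \<open>\<integral>\<integral>\<^sub>\<Gamma> u(x,t) v(x,t) ds(x) dt\<close> for a superposition \<open>u\<close> and a single pulse \<open>v\<close>, all with positive
  amplitudes.  The time integral follows the rule \<open>\<integral> \<delta>(t - \<alpha>) \<delta>(t - \<beta>) dt = \<delta>(\<alpha> - \<beta>)\<close>; a pulse of
  \<open>u\<close> with the same delay function as \<open>v\<close> produces the square of a delta distribution, whose
  integral is \<open>\<infinity>\<close>.  For \<open>green c s\<close> and \<open>green c z\<close> with \<open>c > 0\<close> this happens exactly if \<open>s = z\<close>.
\<close>

definition spacetime_integral :: "(real^3) set \<Rightarrow> pulse list \<Rightarrow> pulse \<Rightarrow> ereal" where
  "spacetime_integral \<Gamma> u v =
     (\<Sum>p\<leftarrow>u. if delay p = delay v then \<infinity>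
             else delta_integral \<Gamma> (\<lambda>x. amp p x * amp v x) (\<lambda>x. delay p x - delay v x))"

definition imaging_indicator :: "real \<Rightarrow> (real^3) set \<Rightarrow> pulse list \<Rightarrow> real^3 \<Rightarrow> ereal" where
  "imaging_indicator c \<Gamma> u z = spacetime_integral \<Gamma> u (green c z)"

end

theory Submission
  imports Defs
begin

text \<open>
  For distinct points \<open>s\<close>, \<open>z\<close> of the disc, the zeros on the boundary circle of
  \<open>h(x) = (|x - s| - |x - z|) / c\<close> are the points on the perpendicular bisector of \<open>s\<close> and \<open>z\<close>.  This
  line passes through the midpoint, which is interior, so there are such points, finitely many, and
  the crossing is transversal, hence the zeros are simple.  At a zero \<open>p\<close> at distance \<open>n\<close> from \<open>s\<close> the
  tangential derivative satisfies \<open>|h'(p)| \<le> |z - s| / (c n)\<close>, since the two distances agree there.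
  With \<open>n \<le> 2 R\<close> the contribution of \<open>s\<close> to the indicator is at least \<open>\<tau> c / (32 \<pi>\<^sup>2 R |z - s|)\<close>; all
  contributions are nonnegative, so the indicator blows up as \<open>z\<close> approaches a source.
\<close>

section \<open>Smoothness of distance functions along a circle\<close>

text \<open>By induction every iterate of \<open>deriv\<close> stays in \<open>F\<close>, and each
  member of \<open>F\<close> is differentiable everywhere. No formula for the n-th derivative has to
  be found.\<close>

lemma smooth_if_closed_under_deriv:
  assumes "g \<in> F"
    and closed: "\<And>g. g \<in> F \<Longrightarrow> \<exists>g'\<in>F. \<forall>t. (g has_real_derivative g' t) (at t)"
  shows "smooth g"
proof -
  have *: "deriv f \<in> F \<and> f differentiable_on UNIV" if "f \<in> F" for f
  proof -
    obtain g' where g': "g' \<in> F" "\<And>t. (f has_real_derivative g' t) (at t)"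
      using closed[OF \<open>f \<in> F\<close>] by blast
    have "deriv f = g'"
      using g'(2) by (auto intro!: DERIV_imp_deriv)
    then show ?thesis
      using g' by (auto simp: differentiable_on_def intro!: real_differentiable_def[THEN iffD2])
  qed
  have "(deriv ^^ n) g \<in> F" for n
    by (induction n) (use assms(1) * in auto)
  then show ?thesis
    using * by (auto simp: smooth_def)
qed

text \<open>Centre, radius and frame are free of any ambient plane here, so that the setting can
  also be instantiated with the a priori unknown data of an arbitrary parametrization in
  \<open>plane_circleI\<close>.\<close>

locale orthonormal_circle =
  fixes a e1 e2 :: "real^3" and R :: real
  assumes R_pos: "R > 0" and norm_e1: "norm e1 = 1" and norm_e2: "norm e2 = 1"
    and orth: "e1 \<bullet> e2 = 0"
begin

abbreviation \<gamma> :: "real \<Rightarrow> real^3" where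
  "\<gamma> \<equiv> circle_arc a R e1 e2"

abbreviation \<gamma>' :: "real \<Rightarrow> real^3" where
  "\<gamma>' t \<equiv> cos (t / R) *\<^sub>R e2 - sin (t / R) *\<^sub>R e1"

lemma inner_e: "e1 \<bullet> e1 = 1" "e2 \<bullet> e2 = 1" "e1 \<bullet> e2 = 0" "e2 \<bullet> e1 = 0"
  using norm_e1 norm_e2 orth by (auto simp: norm_eq_1 inner_commute)

lemma norm_direction [simp]: "norm (cos t *\<^sub>R e1 + sin t *\<^sub>R e2) = 1"
  by (simp add: norm_eq_1 inner_add_left inner_add_right inner_e flip: power2_eq_square)

lemma circle_arc_alt: "\<gamma> t = a + R *\<^sub>R (cos (t / R) *\<^sub>R e1 + sin (t / R) *\<^sub>R e2)"
  by (simp add: circle_arc_def scaleR_add_right)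

lemma dist_circle_arc_center: "norm (\<gamma> t - a) = R"
  using R_pos by (simp add: circle_arc_alt)

lemma circle_arc_has_vector_derivative: "(\<gamma> has_vector_derivative \<gamma>' t) (at t)"
  unfolding circle_arc_def[abs_def] has_vector_derivative_def using R_pos
  by (auto intro!: derivative_eq_intros simp: algebra_simps)

lemma norm_circle_arc_deriv:
  assumes "\<gamma> t \<noteq> p"
  shows "((\<lambda>t. norm (\<gamma> t - p)) has_real_derivative
           ((\<gamma> t - p) \<bullet> \<gamma>' t) / norm (\<gamma> t - p)) (at t)"
proof -
  have "((\<lambda>t. (\<gamma> t - p) \<bullet> (\<gamma> t - p)) has_real_derivative 2 * ((\<gamma> t - p) \<bullet> \<gamma>' t)) (at t)"
    using circle_arc_has_vector_derivative[of t]
    unfolding has_vector_derivative_def has_field_derivative_def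
    by (auto intro!: derivative_eq_intros simp: inner_commute fun_eq_iff algebra_simps)
  then show ?thesis
    unfolding norm_eq_sqrt_inner using assms inner_gt_zero_iff[of "\<gamma> t - p"]
    by (auto intro!: derivative_eq_intros simp: field_simps dest: inner_ge_zero[THEN leD, THEN notE])
qed

text \<open>The tangent is orthogonal to the radius vector \<open>\<gamma> t - a\<close>, so only
  the constant vector \<open>a - p\<close> contributes. The result is visibly built from generators
  of the algebra below.\<close>

lemma inner_circle_arc_deriv:
  "(\<gamma> t - p) \<bullet> \<gamma>' t = ((a - p) \<bullet> e2) * cos (t / R) - ((a - p) \<bullet> e1) * sin (t / R)"
  by (simp add: circle_arc_def inner_add_left inner_diff_left inner_diff_right inner_e algebra_simps)

text \<open>
  Smoothness is obtained from an algebra of functions that contains the distances along the circle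
  to the points of \<open>Q\<close> and is closed under differentiation.
\<close>

inductive_set distance_algebra :: "(real^3) set \<Rightarrow> (real \<Rightarrow> real) set" for Q where
  const: "(\<lambda>t. k) \<in> distance_algebra Q"
| cos: "(\<lambda>t. cos (t / R)) \<in> distance_algebra Q"
| sin: "(\<lambda>t. sin (t / R)) \<in> distance_algebra Q"
| dist: "p \<in> Q \<Longrightarrow> (\<lambda>t. norm (\<gamma> t - p)) \<in> distance_algebra Q"
| inverse_dist: "p \<in> Q \<Longrightarrow> (\<lambda>t. inverse (norm (\<gamma> t - p))) \<in> distance_algebra Q"
| add: "f \<in> distance_algebra Q \<Longrightarrow> g \<in> distance_algebra Q \<Longrightarrow> (\<lambda>t. f t + g t) \<in> distance_algebra Q"
| mult: "f \<in> distance_algebra Q \<Longrightarrow> g \<in> distance_algebra Q \<Longrightarrow> (\<lambda>t. f t * g t) \<in> distance_algebra Q"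

lemma distance_algebra_diff:
  assumes "f \<in> distance_algebra Q" "g \<in> distance_algebra Q"
  shows "(\<lambda>t. f t - g t) \<in> distance_algebra Q"
  using distance_algebra.add[OF assms(1) distance_algebra.mult[OF distance_algebra.const assms(2)], of "-1"]
  by simp

text \<open>Differentiating a distance divides by that distance, and differentiating its inverse
  yields further inverse factors; both stay inside because \<open>inverse_dist\<close> is a
  generator. By \<open>off\<close> the distances never vanish on the circle.\<close>

lemma distance_algebra_closed_under_deriv:
  assumes "f \<in> distance_algebra Q" and off: "\<And>p t. p \<in> Q \<Longrightarrow> \<gamma> t \<noteq> p"
  shows "\<exists>f'\<in>distance_algebra Q. \<forall>t. (f has_real_derivative f' t) (at t)"
  using assms(1)
proof induction
  case (const k)
  show ?case
    by (rule bexI[of _ "\<lambda>_. 0"]) (auto intro: distance_algebra.const)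
next
  case cos
  show ?case
  proof (intro bexI allI)
    show "(\<lambda>t. (- 1 / R) * sin (t / R)) \<in> distance_algebra Q"
      by (intro distance_algebra.intros)
  qed (use R_pos in \<open>auto intro!: derivative_eq_intros\<close>)
next
  case sin
  show ?case
  proof (intro bexI allI)
    show "(\<lambda>t. (1 / R) * cos (t / R)) \<in> distance_algebra Q"
      by (intro distance_algebra.intros)
  qed (use R_pos in \<open>auto intro!: derivative_eq_intros\<close>)
next
  case (dist p)
  let ?d = "\<lambda>t. (((a - p) \<bullet> e2) * cos (t / R) - ((a - p) \<bullet> e1) * sin (t / R))
              * inverse (norm (\<gamma> t - p))"
  have "?d \<in> distance_algebra Q"
    using dist by (intro distance_algebra.intros distance_algebra_diff)
  moreover have "((\<lambda>t. norm (\<gamma> t - p)) has_real_derivative ?d t) (at t)" for t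
    using norm_circle_arc_deriv[OF off[OF dist], unfolded inner_circle_arc_deriv]
      by (simp only: divide_inverse)
  ultimately show ?case
    by (intro bexI[of _ ?d] allI)
next
  case (inverse_dist p)
  let ?d = "\<lambda>t. (((a - p) \<bullet> e2) * cos (t / R) - ((a - p) \<bullet> e1) * sin (t / R))
              * inverse (norm (\<gamma> t - p))"
  let ?i = "\<lambda>t. ((- 1) * ?d t) * (inverse (norm (\<gamma> t - p)) * inverse (norm (\<gamma> t - p)))"
  have "?i \<in> distance_algebra Q"
    using inverse_dist by (intro distance_algebra.intros distance_algebra_diff)
  moreover have "((\<lambda>t. inverse (norm (\<gamma> t - p))) has_real_derivative ?i t) (at t)" for t
  proof -
    have "((\<lambda>t. norm (\<gamma> t - p)) has_real_derivative ?d t) (at t)"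
      using norm_circle_arc_deriv[OF off[OF inverse_dist], unfolded inner_circle_arc_deriv]
      by (simp only: divide_inverse)
    from DERIV_inverse'[OF this] show ?thesis
      using off[OF inverse_dist, of t] by (simp add: algebra_simps)
  qed
  ultimately show ?case
    by (intro bexI[of _ ?i] allI)
next
  case (add f g)
  then obtain f' g' where d: "f' \<in> distance_algebra Q" "g' \<in> distance_algebra Q"
    "\<And>t. (f has_real_derivative f' t) (at t)" "\<And>t. (g has_real_derivative g' t) (at t)"
    by blast
  then show ?case
    by (intro bexI[of _ "\<lambda>t. f' t + g' t"] allI DERIV_add distance_algebra.add)
next
  case (mult f g)
  then obtain f' g' where d: "f' \<in> distance_algebra Q" "g' \<in> distance_algebra Q"
    "\<And>t. (f has_real_derivative f' t) (at t)" "\<And>t. (g has_real_derivative g' t) (at t)"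
    by blast
  with mult.hyps show ?case
    by (intro bexI[of _ "\<lambda>t. f' t * g t + g' t * f t"] allI DERIV_mult distance_algebra.intros)
qed

lemma smooth_distance_algebra:
  assumes "f \<in> distance_algebra Q" "\<And>p t. p \<in> Q \<Longrightarrow> \<gamma> t \<noteq> p"
  shows "smooth f"
  using assms(1) distance_algebra_closed_under_deriv[OF _ assms(2)]
  by (rule smooth_if_closed_under_deriv)

end

section \<open>Zeros on the circle of the difference of two distances\<close>

text \<open>The frame is tied to \<open>P\<close> by \<open>range_circle_arc\<close>: through it
  every direction of \<open>P\<close> becomes a combination of \<open>e1\<close> and
  \<open>e2\<close>.\<close>

locale plane_circle = orthonormal_circle +
  fixes P :: "(real^3) set"
  assumes affine_P: "affine P" and center_in: "a \<in> P"
    and range_circle_arc: "\<gamma> ` {0..<2 * pi * R} = P \<inter> sphere a R"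
begin

lemma circle_arc_image: "\<gamma> t \<in> \<gamma> ` {0..<2 * pi * R}"
proof -
  obtain t' where t': "0 \<le> t'" "t' < 2 * pi" "cos (t / R) = cos t'" "sin (t / R) = sin t'"
    using sincos_total_2pi[of "cos (t / R)" "sin (t / R)"] by auto
  have "\<gamma> t = \<gamma> (R * t')"
    using R_pos t' by (simp add: circle_arc_def)
  moreover have "R * t' \<in> {0..<2 * pi * R}"
    using R_pos t' by (simp add: mult.commute)
  ultimately show ?thesis
    by (rule image_eqI)
qed

lemma circle_arc_neq_interior:
  assumes "p \<in> ball a R"
  shows "\<gamma> t \<noteq> p"
  using dist_circle_arc_center[of t] assms by (auto simp: dist_norm norm_minus_commute)

text \<open>Rescaled to length \<open>R\<close> and attached to the centre, the chord ends at a
  point of the circle; the angle of that point is \<open>\<phi>\<close>.\<close>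

lemma chord_direction:
  assumes "x \<in> P" "y \<in> P" "x \<noteq> y"
  obtains \<phi> where "y - x = norm (y - x) *\<^sub>R (cos \<phi> *\<^sub>R e1 + sin \<phi> *\<^sub>R e2)"
proof -
  let ?v = "(R / norm (y - x)) *\<^sub>R (y - x)"
  have "a + ?v \<in> P"
    using assms affine_P center_in by (intro mem_affine_3_minus)
  moreover have "norm ?v = R"
    using assms R_pos by simp
  ultimately have "a + ?v \<in> \<gamma> ` {0..<2 * pi * R}"
    unfolding range_circle_arc by (simp add: dist_norm)
  then obtain t where "a + ?v = \<gamma> t"
    by blast
  then have "?v = R *\<^sub>R (cos (t / R) *\<^sub>R e1 + sin (t / R) *\<^sub>R e2)"
    by (simp add: circle_arc_alt)
  then have "(norm (y - x) / R) *\<^sub>R ?v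
      = (norm (y - x) / R) *\<^sub>R R *\<^sub>R (cos (t / R) *\<^sub>R e1 + sin (t / R) *\<^sub>R e2)"
    by (simp only:)
  then have "y - x = norm (y - x) *\<^sub>R (cos (t / R) *\<^sub>R e1 + sin (t / R) *\<^sub>R e2)"
    using R_pos assms(3) by simp
  then show ?thesis
    by (rule that)
qed

text \<open>In the angle \<open>t / R\<close>, measured from the direction \<open>\<phi>\<close> of
  \<open>z - s\<close>, a zero is a solution of \<open>cos (t / R - \<phi>) = \<kappa>\<close> with
  \<open>\<bar>\<kappa>\<bar> < 1\<close>. Existence, finiteness and simplicity are read off from
  this equation.\<close>

lemma distance_difference_zeros:
  assumes s: "s \<in> P \<inter> ball a R" and z: "z \<in> P \<inter> ball a R" and "s \<noteq> z" and "c > 0"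
  defines "h \<equiv> \<lambda>x. norm (x - s) / c - norm (x - z) / c"
  defines "Z \<equiv> {t \<in> {0..<2 * pi * R}. h (\<gamma> t) = 0}"
  shows "finite Z" and "Z \<noteq> {}"
    and "t \<in> Z \<Longrightarrow> 0 < \<bar>deriv (h \<circ> \<gamma>) t\<bar>
           \<and> \<bar>deriv (h \<circ> \<gamma>) t\<bar> \<le> norm (z - s) / (c * norm (\<gamma> t - s))"
proof -
  define d where "d = norm (z - s)"
  have d_pos: "d > 0"
    using \<open>s \<noteq> z\<close> by (simp add: d_def)
  obtain \<phi> where \<phi>: "z - s = d *\<^sub>R (cos \<phi> *\<^sub>R e1 + sin \<phi> *\<^sub>R e2)"
    using chord_direction[of s z] s z \<open>s \<noteq> z\<close> unfolding d_def by blast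
  define m where "m = (1 / 2) *\<^sub>R (s + z)"
  \<comment> \<open>This is the signed distance from the centre to the perpendicular bisector, in
    units of \<open>R\<close>.\<close>
  define \<kappa> where "\<kappa> = (m - a) \<bullet> (z - s) / (R * d)"
  have "m \<in> ball a R"
    using convexD_alt[OF convex_ball, of s a R z "1 / 2"] s z by (simp add: m_def scaleR_add_right)
  then have "norm (m - a) * d < R * d"
    using d_pos by (simp add: dist_norm norm_minus_commute)
  moreover have "\<bar>(m - a) \<bullet> (z - s)\<bar> \<le> norm (m - a) * d"
    unfolding d_def by (rule Cauchy_Schwarz_ineq2)
  ultimately have \<kappa>: "\<bar>\<kappa>\<bar> < 1"
    using d_pos R_pos by (simp add: \<kappa>_def abs_mult less_le_trans le_less_trans)
  have inner_arc: "(\<gamma> t - a) \<bullet> (z - s) = R * d * cos (t / R - \<phi>)" for t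
    by (simp add: \<phi> circle_arc_def inner_add_left inner_add_right inner_e cos_diff algebra_simps)
  have inner_tangent: "\<gamma>' t \<bullet> (z - s) = - d * sin (t / R - \<phi>)" for t
    by (simp add: \<phi> inner_diff_left inner_add_right inner_e sin_diff algebra_simps)
  have zero_iff: "h (\<gamma> t) = 0 \<longleftrightarrow> cos (t / R - \<phi>) = \<kappa>" for t
  proof -
    have "h (\<gamma> t) = 0 \<longleftrightarrow> norm (\<gamma> t - s) = norm (\<gamma> t - z)"
      using \<open>c > 0\<close> by (simp add: h_def field_simps)
    also have "\<dots> \<longleftrightarrow> (\<gamma> t - s) \<bullet> (\<gamma> t - s) = (\<gamma> t - z) \<bullet> (\<gamma> t - z)"
      by (simp add: norm_eq)
    \<comment> \<open>The quadratic terms in \<open>\<gamma> t\<close> cancel, leaving the linear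
      equation of the bisector through \<open>m\<close>.\<close>
    also have "\<dots> \<longleftrightarrow> (\<gamma> t - a) \<bullet> (z - s) = (m - a) \<bullet> (z - s)"
      unfolding m_def
      by (simp add: inner_diff_left inner_diff_right inner_add_left inner_add_right inner_commute)
         (auto simp: algebra_simps)
    also have "\<dots> \<longleftrightarrow> cos (t / R - \<phi>) = \<kappa>"
      using R_pos d_pos by (simp add: inner_arc \<kappa>_def field_simps)
    finally show ?thesis .
  qed
  have arccos: "cos (arccos \<kappa>) = \<kappa>"
    using \<kappa> by (simp add: abs_less_iff)
  show "finite Z"
  proof (rule finite_subset)
    \<comment> \<open>A cosine determines its angle up to sign and full turns \<open>n\<close>.
      Since \<open>t / R\<close> lies between 0 and \<open>2 * pi\<close>, the number of turns is
      bounded, so only finitely many candidates remain.\<close>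
    define N where "N = {n :: real \<in> \<int>. - (\<bar>\<phi>\<bar> + \<bar>arccos \<kappa>\<bar> + 2 * pi) \<le> n
                          \<and> n \<le> \<bar>\<phi>\<bar> + \<bar>arccos \<kappa>\<bar> + 2 * pi}"
    define T where "T = (\<lambda>n. R * (\<phi> + arccos \<kappa> + 2 * n * pi)) ` N
                      \<union> (\<lambda>n. R * (\<phi> - arccos \<kappa> + 2 * n * pi)) ` N"
    show "finite T"
      unfolding T_def N_def by (intro finite_UnI finite_imageI finite_int_segment)
    show "Z \<subseteq> T"
    proof
      fix t assume "t \<in> Z"
      then have t: "0 \<le> t / R" "t / R < 2 * pi" "cos (t / R - \<phi>) = cos (arccos \<kappa>)"
        using R_pos zero_iff by (auto simp: Z_def arccos field_simps)
      then obtain n where n: "n \<in> \<int>"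
        "t / R - \<phi> = arccos \<kappa> + 2 * n * pi \<or> t / R - \<phi> = - arccos \<kappa> + 2 * n * pi"
        unfolding cos_eq by blast
      have "\<bar>2 * n * pi\<bar> \<le> \<bar>\<phi>\<bar> + \<bar>arccos \<kappa>\<bar> + 2 * pi"
        using n(2) t(1,2) by linarith
      moreover have "\<bar>n\<bar> * 1 \<le> \<bar>n\<bar> * (2 * pi)"
        using pi_gt3 by (intro mult_left_mono) auto
      ultimately have "\<bar>n\<bar> \<le> \<bar>\<phi>\<bar> + \<bar>arccos \<kappa>\<bar> + 2 * pi"
        by (simp add: abs_mult mult_ac)
      then have "n \<in> N"
        using n(1) by (auto simp: N_def)
      moreover have "t = R * (\<phi> + arccos \<kappa> + 2 * n * pi) \<or> t = R * (\<phi> - arccos \<kappa> + 2 * n * pi)"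
        using n(2) R_pos by (auto simp: field_simps)
      ultimately show "t \<in> T"
        by (auto simp: T_def)
    qed
  qed
  show "Z \<noteq> {}"
  proof -
    have "h (\<gamma> (R * (\<phi> + arccos \<kappa>))) = 0"
      using R_pos by (simp add: zero_iff arccos)
    \<comment> \<open>The angle \<open>\<phi> + arccos \<kappa>\<close> may lie outside the basic
      period, so the point is represented by another parameter.\<close>
    moreover obtain t where "t \<in> {0..<2 * pi * R}" "\<gamma> (R * (\<phi> + arccos \<kappa>)) = \<gamma> t"
      using circle_arc_image[of "R * (\<phi> + arccos \<kappa>)"] by blast
    ultimately show ?thesis
      by (auto simp: Z_def)
  qed
  show "0 < \<bar>deriv (h \<circ> \<gamma>) t\<bar> \<and> \<bar>deriv (h \<circ> \<gamma>) t\<bar> \<le> norm (z - s) / (c * norm (\<gamma> t - s))"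
    if "t \<in> Z" for t
  proof -
    have ne: "\<gamma> t \<noteq> s" "\<gamma> t \<noteq> z"
      using s z by (auto intro!: circle_arc_neq_interior)
    have h0: "h (\<gamma> t) = 0"
      using that by (simp add: Z_def)
    then have eq: "norm (\<gamma> t - z) = norm (\<gamma> t - s)"
      using \<open>c > 0\<close> by (simp add: h_def)
    have "((h \<circ> \<gamma>) has_real_derivative
            ((\<gamma> t - s) \<bullet> \<gamma>' t) / norm (\<gamma> t - s) / c - ((\<gamma> t - z) \<bullet> \<gamma>' t) / norm (\<gamma> t - z) / c) (at t)"
      unfolding h_def o_def by (intro DERIV_diff DERIV_cdivide norm_circle_arc_deriv ne)
    \<comment> \<open>At a zero both distances agree, so the quotients share a denominator, and the
      difference of the numerators is the tangential component of \<open>z - s\<close>.\<close>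
    also have "((\<gamma> t - s) \<bullet> \<gamma>' t) / norm (\<gamma> t - s) / c - ((\<gamma> t - z) \<bullet> \<gamma>' t) / norm (\<gamma> t - z) / c
        = ((\<gamma> t - s) \<bullet> \<gamma>' t - (\<gamma> t - z) \<bullet> \<gamma>' t) / (c * norm (\<gamma> t - s))"
      unfolding eq by (simp add: diff_divide_distrib mult.commute)
    also have "(\<gamma> t - s) \<bullet> \<gamma>' t - (\<gamma> t - z) \<bullet> \<gamma>' t = - d * sin (t / R - \<phi>)"
      unfolding inner_tangent[symmetric] by (simp add: inner_diff_left inner_diff_right inner_commute algebra_simps)
    finally have deriv: "deriv (h \<circ> \<gamma>) t = - d * sin (t / R - \<phi>) / (c * norm (\<gamma> t - s))"
      by (rule DERIV_imp_deriv)
    \<comment> \<open>At a zero the squared sine is \<open>1 - \<kappa>\<^sup>2\<close>, which is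
      positive: the bisector crosses the circle transversally.\<close>
    have "\<kappa>\<^sup>2 < 1"
      using \<kappa> by (simp add: abs_square_less_1)
    then have "sin (t / R - \<phi>) \<noteq> 0"
      using h0 sin_cos_squared_add[of "t / R - \<phi>"] by (auto simp: zero_iff)
    moreover have "d * \<bar>sin (t / R - \<phi>)\<bar> \<le> d * 1"
      using d_pos by (intro mult_left_mono) auto
    moreover have "c * norm (\<gamma> t - s) > 0"
      using \<open>c > 0\<close> ne by simp
    ultimately show ?thesis
      using d_pos unfolding deriv d_def[symmetric]
      by (simp add: abs_mult divide_right_mono zero_less_mult_iff)
  qed
qed

section \<open>The delta integral for a single source\<close>

text \<open>The assumption \<open>param\<close> describes the parametrization that
  \<open>SOME\<close> picks inside \<open>delta_integral\<close>. Each summand obeys the claimed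
  lower bound, so one zero suffices for it.\<close>

lemma delta_integral_wave:
  assumes s: "s \<in> P \<inter> ball a R" and z: "z \<in> P \<inter> ball a R" and "s \<noteq> z" and "c > 0" and "k > 0"
    and param: "(SOME (g, L). arclength_circle (P \<inter> sphere a R) g L) = (\<gamma>, 2 * pi * R)"
  defines "I \<equiv> delta_integral (P \<inter> sphere a R)
                 (\<lambda>x. amp (scale_pulse k (green c s)) x * amp (green c z) x)
                 (\<lambda>x. delay (scale_pulse k (green c s)) x - delay (green c z) x)"
  shows "I < \<infinity>" and "I \<ge> ereal (k * c / (32 * pi\<^sup>2 * R * norm (z - s)))"
proof -
  define h where "h = (\<lambda>x. norm (x - s) / c - norm (x - z) / c)"
  define f where "f = (\<lambda>x. k * (1 / (4 * pi * norm (x - s))) * (1 / (4 * pi * norm (x - z))))"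
  define Z where "Z = {t \<in> {0..<2 * pi * R}. h (\<gamma> t) = 0}"
  have "finite Z" "Z \<noteq> {}"
    and Z: "\<And>t. t \<in> Z \<Longrightarrow> 0 < \<bar>deriv (h \<circ> \<gamma>) t\<bar>
             \<and> \<bar>deriv (h \<circ> \<gamma>) t\<bar> \<le> norm (z - s) / (c * norm (\<gamma> t - s))"
    using distance_difference_zeros[OF s z \<open>s \<noteq> z\<close> \<open>c > 0\<close>] unfolding h_def Z_def by blast+
  have off: "\<gamma> t \<noteq> p" if "p \<in> {s, z}" for p t
    using that s z by (intro circle_arc_neq_interior) auto
  have "(\<lambda>t. inverse c * norm (\<gamma> t - s) - inverse c * norm (\<gamma> t - z)) \<in> distance_algebra {s, z}"
    by (intro distance_algebra.intros distance_algebra_diff) auto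
  moreover have "h \<circ> \<gamma> = (\<lambda>t. inverse c * norm (\<gamma> t - s) - inverse c * norm (\<gamma> t - z))"
    by (simp add: h_def fun_eq_iff divide_inverse mult.commute)
  ultimately have "smooth (h \<circ> \<gamma>)"
    using off by (auto intro: smooth_distance_algebra)
  moreover have "continuous_on (P \<inter> sphere a R) f"
    using s z unfolding f_def by (intro continuous_intros) auto
  moreover have "I = delta_integral (P \<inter> sphere a R) f h"
    unfolding I_def f_def h_def by (simp add: scale_pulse_def green_def)
  moreover have "delta_integral (P \<inter> sphere a R) f h =
      (if continuous_on (P \<inter> sphere a R) f \<and> smooth (h \<circ> \<gamma>) \<and> finite Z
          \<and> (\<forall>t\<in>Z. deriv (h \<circ> \<gamma>) t \<noteq> 0)
       then ereal (\<Sum>t\<in>Z. f (\<gamma> t) / \<bar>deriv (h \<circ> \<gamma>) t\<bar>) else \<infinity>)"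
    by (simp only: delta_integral_def param Let_def prod.case Z_def)
  moreover have "\<forall>t\<in>Z. deriv (h \<circ> \<gamma>) t \<noteq> 0"
    using Z by (metis abs_zero less_irrefl)
  ultimately have I: "I = ereal (\<Sum>t\<in>Z. f (\<gamma> t) / \<bar>deriv (h \<circ> \<gamma>) t\<bar>)"
    using \<open>finite Z\<close> by (metis (no_types, lifting))
  then show "I < \<infinity>"
    by simp
  have summand: "k * c / (32 * pi\<^sup>2 * R * norm (z - s)) \<le> f (\<gamma> t) / \<bar>deriv (h \<circ> \<gamma>) t\<bar>"
    if "t \<in> Z" for t
  proof -
    define n where "n = norm (\<gamma> t - s)"
    have "n > 0"
      using off[of s t] by (simp add: n_def)
    have "norm (\<gamma> t - z) = n"
      using that \<open>c > 0\<close> by (simp add: Z_def h_def n_def)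
    then have f: "f (\<gamma> t) = k / (16 * pi\<^sup>2 * n\<^sup>2)"
      by (simp add: f_def n_def power2_eq_square)
    have "n \<le> norm (\<gamma> t - a) + norm (a - s)"
      unfolding n_def using norm_triangle_ineq[of "\<gamma> t - a" "a - s"] by simp
    then have "n \<le> 2 * R"
      using s by (simp add: dist_circle_arc_center dist_norm)
    \<comment> \<open>The amplitude \<open>k / (16 * pi\<^sup>2 * n\<^sup>2)\<close> divided by the
      derivative bound \<open>norm (z - s) / (c * n)\<close> is proportional to
      \<open>1 / n\<close>; estimating \<open>n\<close> by \<open>2 * R\<close> turns 16 into
      32.\<close>
    have "k * c / (32 * pi\<^sup>2 * R * norm (z - s)) = (k * c / (16 * pi\<^sup>2 * norm (z - s))) / (2 * R)"
      by simp
    also have "\<dots> \<le> (k * c / (16 * pi\<^sup>2 * norm (z - s))) / n"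
      using \<open>n \<le> 2 * R\<close> \<open>n > 0\<close> \<open>k > 0\<close> \<open>c > 0\<close> by (intro divide_left_mono) auto
    also have "\<dots> = f (\<gamma> t) / (norm (z - s) / (c * n))"
      using \<open>n > 0\<close> by (simp add: f power2_eq_square)
    also have "\<dots> \<le> f (\<gamma> t) / \<bar>deriv (h \<circ> \<gamma>) t\<bar>"
      using Z[OF that] \<open>k > 0\<close> \<open>n > 0\<close> \<open>c > 0\<close> \<open>s \<noteq> z\<close>
      by (intro divide_left_mono) (auto simp: f n_def)
    finally show ?thesis .
  qed
  have nonneg: "0 \<le> k * c / (32 * pi\<^sup>2 * R * norm (z - s))"
    using \<open>k > 0\<close> \<open>c > 0\<close> R_pos by simp
  obtain t where "t \<in> Z"
    using \<open>Z \<noteq> {}\<close> by blast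
  have "k * c / (32 * pi\<^sup>2 * R * norm (z - s)) \<le> f (\<gamma> t) / \<bar>deriv (h \<circ> \<gamma>) t\<bar>"
    by (rule summand) fact
  also have "\<dots> \<le> (\<Sum>t\<in>Z. f (\<gamma> t) / \<bar>deriv (h \<circ> \<gamma>) t\<bar>)"
    using \<open>finite Z\<close> \<open>t \<in> Z\<close> order_trans[OF nonneg summand] by (intro member_le_sum) auto
  finally show "I \<ge> ereal (k * c / (32 * pi\<^sup>2 * R * norm (z - s)))"
    unfolding I by simp
qed

end

section \<open>Parametrizations of a circle in a plane\<close>

text \<open>
  A circle determines its centre: if the parametrizing data had another centre \<open>b\<close>, the point of
  the circle in direction \<open>b - a\<close> would have to lie in direction orthogonal to \<open>b - a\<close> from \<open>b\<close>.
\<close>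

lemma plane_circleI:
  assumes "affine P" "a \<in> P" "R > 0" and arc: "arclength_circle (P \<inter> sphere a R) g L"
  obtains e1 e2 where "plane_circle a e1 e2 R P" "g = circle_arc a R e1 e2" "L = 2 * pi * R"
proof -
  obtain b r e1 e2 where r: "r > 0" and e: "norm e1 = 1" "norm e2 = 1" "e1 \<bullet> e2 = 0"
    and g: "g = circle_arc b r e1 e2" and L: "L = 2 * pi * r"
    and img: "P \<inter> sphere a R = g ` {0..<L}"
    using arc unfolding arclength_circle_def by blast
  interpret B: orthonormal_circle b e1 e2 r
    by unfold_locales (use r e in auto)
  have on: "g t \<in> P \<inter> sphere a R" if "0 \<le> t" "t < 2 * pi * r" for t
    using that unfolding img L by auto
  \<comment> \<open>The quarter turns give two antipodal pairs \<open>b + r *\<^sub>R e\<close>,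
    \<open>b - r *\<^sub>R e\<close>. Each pair is equidistant from \<open>a\<close>, which makes
    \<open>b - a\<close> orthogonal to both frame vectors.\<close>
  have quarter: "g 0 \<in> P \<inter> sphere a R" "g (pi / 2 * r) \<in> P \<inter> sphere a R"
    "g (pi * r) \<in> P \<inter> sphere a R" "g (3 / 2 * pi * r) \<in> P \<inter> sphere a R"
    by (rule on; (use r in simp))+
  have vals: "g 0 = b + r *\<^sub>R e1" "g (pi / 2 * r) = b + r *\<^sub>R e2"
    "g (pi * r) = b - r *\<^sub>R e1" "g (3 / 2 * pi * r) = b - r *\<^sub>R e2"
    using r cos_3over2_pi sin_3over2_pi by (auto simp: g circle_arc_def)
  have orth: "(b - a) \<bullet> e = 0" if "norm (b + r *\<^sub>R e - a) = norm (b - r *\<^sub>R e - a)" for e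
  proof -
    have "(b + r *\<^sub>R e - a) \<bullet> (b + r *\<^sub>R e - a) = (b - r *\<^sub>R e - a) \<bullet> (b - r *\<^sub>R e - a)"
      using that by (simp add: norm_eq)
    then have "4 * r * ((b - a) \<bullet> e) = 0"
      by (simp add: inner_diff_left inner_diff_right inner_add_left inner_add_right inner_commute
            algebra_simps)
    then show ?thesis
      using r by simp
  qed
  have norms: "norm (g t - a) = R" if "g t \<in> P \<inter> sphere a R" for t
    using that by (simp add: dist_norm norm_minus_commute)
  have orths: "(b - a) \<bullet> e1 = 0" "(b - a) \<bullet> e2 = 0"
    using quarter[THEN norms] vals by (auto intro!: orth)
  have "b \<in> P"
  proof -
    have "(1 / 2) *\<^sub>R g 0 + (1 / 2) *\<^sub>R g (pi * r) \<in> P"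
      using quarter \<open>affine P\<close> by (intro mem_affine) auto
    also have "(1 / 2) *\<^sub>R g 0 + (1 / 2) *\<^sub>R g (pi * r) = b"
      by (simp add: vals algebra_simps flip: scaleR_add_left)
    finally show ?thesis .
  qed
  have "b = a"
  proof (rule ccontr)
    assume "b \<noteq> a"
    let ?v = "(R / norm (b - a)) *\<^sub>R (b - a)"
    have "a + ?v \<in> P"
      using \<open>affine P\<close> \<open>a \<in> P\<close> \<open>b \<in> P\<close> by (intro mem_affine_3_minus)
    moreover have "norm ?v = R"
      using \<open>R > 0\<close> \<open>b \<noteq> a\<close> by simp
    ultimately have "a + ?v \<in> g ` {0..<L}"
      unfolding img[symmetric] by (simp add: dist_norm)
    then obtain t where t: "a + ?v = g t"
      by blast
    let ?w = "r *\<^sub>R (cos (t / r) *\<^sub>R e1 + sin (t / r) *\<^sub>R e2)"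
    have "?v - (b - a) = ?w"
      using t by (simp add: g B.circle_arc_alt algebra_simps)
    then have "?w = (R / norm (b - a) - 1) *\<^sub>R (b - a)"
      by (simp add: scaleR_diff_left)
    moreover have "(b - a) \<bullet> ?w = 0"
      using orths by (simp add: inner_add_right)
    ultimately have "?w \<bullet> ?w = 0"
      by (metis inner_scaleR_left mult_zero_right)
    then have "?w = 0"
      by (simp only: inner_eq_zero_iff)
    then show False
      using r B.norm_direction[of "t / r"] by auto
  qed
  have "r = R"
    using norms[OF quarter(1)] r e by (simp add: vals \<open>b = a\<close>)
  show ?thesis
  proof
    show "plane_circle a e1 e2 R P"
      by unfold_locales (use assms e img g L \<open>b = a\<close> \<open>r = R\<close> in auto)
  qed (use g L \<open>b = a\<close> \<open>r = R\<close> in auto)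
qed

text \<open>This guarantees that \<open>SOME\<close> in \<open>delta_integral\<close> selects a
  genuine parametrization. The frame is an orthonormal basis of the direction space of
  \<open>P\<close>, and polar coordinates show that the arc fills the circle.\<close>

lemma ex_arclength_circle:
  assumes "affine P" "aff_dim P = 2" "a \<in> P" "R > 0"
  shows "\<exists>g L. arclength_circle (P \<inter> sphere a R) g L"
proof -
  let ?V = "(\<lambda>x. x - a) ` P"
  have V: "subspace ?V"
    using affine_diffs_subspace_subtract[OF \<open>affine P\<close> \<open>a \<in> P\<close>] by simp
  have "dim ?V = 2"
    using aff_dim_eq_dim_subtract[OF hull_inc[OF \<open>a \<in> P\<close>]] \<open>aff_dim P = 2\<close> by simp
  then obtain B where B: "B \<subseteq> ?V" "pairwise orthogonal B" "\<And>x. x \<in> B \<Longrightarrow> norm x = 1"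
    "card B = 2" "span B = ?V"
    using orthonormal_basis_subspace[OF V] by metis
  then obtain e1 e2 where e12: "B = {e1, e2}" "e1 \<noteq> e2"
    by (auto simp: card_2_iff)
  have e: "norm e1 = 1" "norm e2 = 1" "e1 \<bullet> e2 = 0"
    using B(2,3) e12 by (auto simp: pairwise_def orthogonal_def)
  interpret orthonormal_circle a e1 e2 R
    by unfold_locales (use e \<open>R > 0\<close> in auto)
  have mem: "a + v \<in> P \<longleftrightarrow> v \<in> span {e1, e2}" for v
    using B(5) e12 by (auto simp: image_iff algebra_simps)
  have "\<gamma> ` {0..<2 * pi * R} = P \<inter> sphere a R"
  proof (intro equalityI subsetI)
    fix x assume "x \<in> \<gamma> ` {0..<2 * pi * R}"
    then obtain t where x: "x = \<gamma> t"
      by blast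
    have "x \<in> P"
      unfolding x circle_arc_alt mem
      by (intro span_scale span_add span_base) auto
    then show "x \<in> P \<inter> sphere a R"
      using dist_circle_arc_center[of t] x by (simp add: dist_norm norm_minus_commute)
  next
    fix x assume x: "x \<in> P \<inter> sphere a R"
    then have "x - a \<in> span {e1, e2}"
      using mem[of "x - a"] by simp
    then obtain p q where pq: "x - a = p *\<^sub>R e1 + q *\<^sub>R e2"
      by (auto simp: span_insert span_breakdown_eq algebra_simps)
    have "(x - a) \<bullet> (x - a) = R\<^sup>2"
      using x by (simp add: dist_norm norm_minus_commute flip: power2_norm_eq_inner)
    then have "p\<^sup>2 + q\<^sup>2 = R\<^sup>2"
      unfolding pq by (simp add: inner_add_left inner_add_right inner_e power2_eq_square)
    then have "(p / R)\<^sup>2 + (q / R)\<^sup>2 = 1"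
      using R_pos by (simp add: power_divide flip: add_divide_distrib)
    then obtain t where t: "0 \<le> t" "t < 2 * pi" "p / R = cos t" "q / R = sin t"
      by (rule sincos_total_2pi)
    then have "p = R * cos t" "q = R * sin t"
      using R_pos by (auto simp: field_simps)
    then have "x = \<gamma> (t * R)"
      using R_pos pq by (simp add: circle_arc_def algebra_simps)
    moreover have "t * R \<in> {0..<2 * pi * R}"
      using t R_pos by simp
    ultimately show "x \<in> \<gamma> ` {0..<2 * pi * R}"
      by blast
  qed
  then show ?thesis
    unfolding arclength_circle_def using e R_pos by metis
qed

text \<open>Whichever parametrization \<open>SOME\<close> returns, \<open>plane_circleI\<close>
  shows that it comes from a frame centred at \<open>a\<close> with radius \<open>R\<close>, so
  \<open>delta_integral_wave\<close> applies to it.\<close>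

lemma delta_integral_wave_on_circle:
  assumes "affine P" "aff_dim P = 2" "a \<in> P" "R > 0"
    and "s \<in> P \<inter> ball a R" "z \<in> P \<inter> ball a R" "s \<noteq> z" "c > 0" "k > 0"
  defines "I \<equiv> delta_integral (P \<inter> sphere a R)
                 (\<lambda>x. amp (scale_pulse k (green c s)) x * amp (green c z) x)
                 (\<lambda>x. delay (scale_pulse k (green c s)) x - delay (green c z) x)"
  shows "I < \<infinity>" and "I \<ge> ereal (k * c / (32 * pi\<^sup>2 * R * norm (z - s)))"
proof -
  obtain g L where gL: "(SOME (g, L). arclength_circle (P \<inter> sphere a R) g L) = (g, L)"
    by (meson surj_pair)
  have "arclength_circle (P \<inter> sphere a R) g L"
    using someI_ex[of "\<lambda>(g, L). arclength_circle (P \<inter> sphere a R) g L"]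
      ex_arclength_circle[OF assms(1-4)] gL by auto
  then obtain e1 e2 where pc: "plane_circle a e1 e2 R P"
    and "g = circle_arc a R e1 e2" "L = 2 * pi * R"
    using plane_circleI assms(1,3,4) by blast
  then show "I < \<infinity>" "I \<ge> ereal (k * c / (32 * pi\<^sup>2 * R * norm (z - s)))"
    using plane_circle.delta_integral_wave[OF pc assms(5-9)] gL unfolding I_def by auto
qed

section \<open>Summation over the sources and the limit\<close>

text \<open>Comparing the delays at the point \<open>s\<close> is enough: one of them vanishes there
  and the other is the travel time from \<open>z\<close>.\<close>

lemma delay_green_eq_iff:
  assumes "c > 0"
  shows "delay (scale_pulse k (green c s)) = delay (green c z) \<longleftrightarrow> s = z"
proof
  assume "delay (scale_pulse k (green c s)) = delay (green c z)"
  from fun_cong[OF this, of s] have "norm (s - s) / c = norm (s - z) / c"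
    by (simp add: scale_pulse_def green_def)
  then show "s = z"
    using assms by simp
qed (simp add: scale_pulse_def green_def)

text \<open>In \<open>ereal\<close> the sum \<open>\<infinity> + x\<close> is
  \<open>\<infinity>\<close> for every \<open>x\<close>, even for
  \<open>- \<infinity>\<close>.\<close>

lemma sum_list_PInfty:
  fixes xs :: "ereal list"
  assumes "\<infinity> \<in> set xs"
  shows "sum_list xs = \<infinity>"
  using assms by (induction xs) auto

lemma sum_list_less_PInfty:
  fixes xs :: "ereal list"
  assumes "\<And>x. x \<in> set xs \<Longrightarrow> x < \<infinity>"
  shows "sum_list xs < \<infinity>"
  using assms by (induction xs) auto

theorem theorem3p2:
  fixes c R :: real and K :: nat and P \<Omega> D S :: "(real^3) set" and a :: "real^3"
    and s :: "nat \<Rightarrow> real^3" and \<tau> :: "nat \<Rightarrow> real" and u :: "pulse list"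
  assumes "c > 0"
    and "affine P" and "aff_dim P = 2"
    and "K \<ge> 1"
    and "inj_on s {1..K}" and "S = s ` {1..K}" and "S \<subseteq> P"
    and "\<And>j. j \<in> {1..K} \<Longrightarrow> \<tau> j > 0"
    and "u = wave_solution c K s \<tau>"
    and "a \<in> P" and "R > 0" and "\<Omega> = P \<inter> ball a R"
    and "S \<subseteq> \<Omega>" and "D \<subseteq> \<Omega>" and "S \<subseteq> D" and "D \<inter> rel_frontier \<Omega> = {}"
  shows "(\<forall>z\<in>S. imaging_indicator c (rel_frontier \<Omega>) u z = \<infinity>) \<and>
         (\<forall>z\<in>D - S. imaging_indicator c (rel_frontier \<Omega>) u z < \<infinity>) \<and>
         (imaging_indicator c (rel_frontier \<Omega>) u \<longlongrightarrow> \<infinity>)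
            (inf (filtercomap (\<lambda>z. MIN j\<in>{1..K}. norm (z - s j)) (at_right 0)) (principal D))"
proof -
  have \<Gamma>: "rel_frontier \<Omega> = P \<inter> sphere a R"
  proof -
    have "interior (ball a R) \<inter> P \<noteq> {}"
      using \<open>a \<in> P\<close> centre_in_ball[of a R] \<open>R > 0\<close> unfolding interior_ball by blast
    then have "rel_frontier (ball a R \<inter> P) = frontier (ball a R) \<inter> P"
      using \<open>affine P\<close> by (intro convex_affine_rel_frontier_Int) auto
    then show ?thesis
      using \<open>R > 0\<close> by (simp add: \<open>\<Omega> = _\<close> Int_commute)
  qed
  \<comment> \<open>This is the contribution of source \<open>j\<close> to the indicator at
    \<open>z\<close>; the first branch is the squared delta.\<close>
  define T where "T = (\<lambda>z j. let p = scale_pulse (\<tau> j) (green c (s j)); v = green c z in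
      if delay p = delay v then \<infinity>
      else delta_integral (P \<inter> sphere a R) (\<lambda>x. amp p x * amp v x) (\<lambda>x. delay p x - delay v x))"
  have I: "imaging_indicator c (rel_frontier \<Omega>) u z = sum_list (map (T z) [1..<Suc K])" for z
    by (simp add: imaging_indicator_def spacetime_integral_def \<Gamma> \<open>u = _\<close> wave_solution_def
          T_def Let_def o_def del: upt_Suc)
  have idx: "set [1..<Suc K] = {1..K}"
    by auto
  have T_eq: "T z j = \<infinity>" if "s j = z" for z j
    using that delay_green_eq_iff[OF \<open>c > 0\<close>, of "\<tau> j" "s j" z] by (simp add: T_def Let_def)
  have T_neq: "T z j < \<infinity>" "T z j \<ge> ereal (\<tau> j * c / (32 * pi\<^sup>2 * R * norm (z - s j)))"
    if "z \<in> D" "j \<in> {1..K}" "s j \<noteq> z" for z j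
  proof -
    have "s j \<in> P \<inter> ball a R" "z \<in> P \<inter> ball a R" "\<tau> j > 0"
      using assms(6,12-14) that(1,2) assms(8)[OF that(2)] by blast+
    note * = delta_integral_wave_on_circle[OF \<open>affine P\<close> \<open>aff_dim P = 2\<close> \<open>a \<in> P\<close> \<open>R > 0\<close>
        this(1,2) \<open>s j \<noteq> z\<close> \<open>c > 0\<close> this(3)]
    have "delay (scale_pulse (\<tau> j) (green c (s j))) \<noteq> delay (green c z)"
      using delay_green_eq_iff[OF \<open>c > 0\<close>] \<open>s j \<noteq> z\<close> by simp
    then show "T z j < \<infinity>" "T z j \<ge> ereal (\<tau> j * c / (32 * pi\<^sup>2 * R * norm (z - s j)))"
      using * by (simp_all only: T_def Let_def if_False)
  qed
  \<comment> \<open>Nonnegativity lets all sources except the nearest be dropped from the sum in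
    \<open>lower\<close>.\<close>
  have T_nonneg: "T z j \<ge> 0" if "z \<in> D" "j \<in> {1..K}" for z j
  proof (cases "s j = z")
    case False
    have "0 \<le> \<tau> j * c / (32 * pi\<^sup>2 * R * norm (z - s j))"
      using assms(8)[OF that(2)] \<open>c > 0\<close> \<open>R > 0\<close> by simp
    then show ?thesis
      using T_neq(2)[OF that False] by (meson ereal_less_eq(5) order_trans)
  qed (simp add: T_eq)
  have at_sources: "\<forall>z\<in>S. imaging_indicator c (rel_frontier \<Omega>) u z = \<infinity>"
  proof
    fix z assume "z \<in> S"
    then obtain j where "j \<in> {1..K}" "s j = z"
      using \<open>S = _\<close> by blast
    then have "\<infinity> \<in> set (map (T z) [1..<Suc K])"
      unfolding set_map idx using T_eq by (intro image_eqI[of _ _ j]) auto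
    then show "imaging_indicator c (rel_frontier \<Omega>) u z = \<infinity>"
      unfolding I by (rule sum_list_PInfty)
  qed
  have off_sources: "\<forall>z\<in>D - S. imaging_indicator c (rel_frontier \<Omega>) u z < \<infinity>"
  proof
    fix z assume z: "z \<in> D - S"
    have "T z j < \<infinity>" if "j \<in> {1..K}" for j
      using z that \<open>S = _\<close> by (intro T_neq(1)) auto
    then show "imaging_indicator c (rel_frontier \<Omega>) u z < \<infinity>"
      unfolding I by (intro sum_list_less_PInfty) (auto simp del: upt_Suc simp: idx)
  qed
  \<comment> \<open>The least intensity makes the constant independent of which source is nearest to
    \<open>z\<close>.\<close>
  define B where "B = (MIN j\<in>{1..K}. \<tau> j) * c / (32 * pi\<^sup>2 * R)"
  have "(MIN j\<in>{1..K}. \<tau> j) > 0"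
    using assms(8) \<open>K \<ge> 1\<close> by (subst Min_gr_iff) auto
  then have "B > 0"
    using \<open>c > 0\<close> \<open>R > 0\<close> by (simp add: B_def)
  have lower: "imaging_indicator c (rel_frontier \<Omega>) u z
      \<ge> ereal (B / (MIN j\<in>{1..K}. norm (z - s j)))"
    if "z \<in> D" and pos: "(MIN j\<in>{1..K}. norm (z - s j)) > 0" for z
  proof -
    have "(MIN j\<in>{1..K}. norm (z - s j)) \<in> (\<lambda>j. norm (z - s j)) ` {1..K}"
      using \<open>K \<ge> 1\<close> by (intro Min_in) auto
    then obtain j where j: "j \<in> {1..K}" "(MIN j\<in>{1..K}. norm (z - s j)) = norm (z - s j)"
      by blast
    then have "s j \<noteq> z"
      using pos by auto
    have "(MIN j\<in>{1..K}. \<tau> j) * (c / (32 * pi\<^sup>2 * R * norm (z - s j)))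
        \<le> \<tau> j * (c / (32 * pi\<^sup>2 * R * norm (z - s j)))"
      using j(1) \<open>c > 0\<close> \<open>R > 0\<close> by (intro mult_right_mono Min_le) auto
    then have "ereal (B / norm (z - s j)) \<le> ereal (\<tau> j * c / (32 * pi\<^sup>2 * R * norm (z - s j)))"
      by (simp add: B_def)
    also have "\<dots> \<le> T z j"
      using \<open>z \<in> D\<close> j(1) \<open>s j \<noteq> z\<close> by (rule T_neq(2))
    also have "\<dots> \<le> sum (T z) {1..K}"
      using sum_mono2[of "{1..K}" "{j}" "T z"] T_nonneg[OF \<open>z \<in> D\<close>] j(1) by simp
    also have "\<dots> = sum_list (map (T z) [1..<Suc K])"
      using sum_list_distinct_conv_sum_set[OF distinct_upt, of "T z" 1 "Suc K"] unfolding idx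
      by (rule sym)
    finally show ?thesis
      unfolding I j(2) .
  qed
  \<comment> \<open>The filter \<open>at_right 0\<close> admits only positive distances to the
    sources; distance zero is the case of \<open>at_sources\<close>.\<close>
  have "(imaging_indicator c (rel_frontier \<Omega>) u \<longlongrightarrow> \<infinity>)
            (inf (filtercomap (\<lambda>z. MIN j\<in>{1..K}. norm (z - s j)) (at_right 0)) (principal D))"
    unfolding tendsto_PInfty eventually_inf_principal eventually_filtercomap
  \<comment> \<open>The predicate on distances \<open>y\<close> that witnesses
    \<open>eventually_filtercomap\<close> is \<open>0 < y \<and> r < B / y\<close>;
    \<open>lower\<close> transfers it to the indicator.\<close>
  proof (intro allI exI conjI impI)
    fix r :: real
    show "\<forall>\<^sub>F y in at_right 0. 0 < y \<and> r < B / y"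
    proof -
      \<comment> \<open>The denominator \<open>\<bar>r\<bar> + 1\<close> is positive for either sign
        of \<open>r\<close> and exceeds \<open>r\<close>.\<close>
      have "eventually (\<lambda>y. y \<in> {0<..<B / (\<bar>r\<bar> + 1)}) (at_right (0::real))"
        using \<open>B > 0\<close> by (intro eventually_at_right_real) simp
      then show ?thesis
      proof eventually_elim
        case (elim y)
        then have "(\<bar>r\<bar> + 1) < B / y"
          by (simp add: field_simps)
        with elim show ?case
          by auto
      qed
    qed
    fix z assume "0 < (MIN j\<in>{1..K}. norm (z - s j)) \<and> r < B / (MIN j\<in>{1..K}. norm (z - s j))"
      and "z \<in> D"
    then show "ereal r < imaging_indicator c (rel_frontier \<Omega>) u z"
      using lower[of z] by (meson less_ereal.simps(1) less_le_trans)
  qed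
  with at_sources off_sources show ?thesis
    by blast
qed

end
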